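(* If $\lambda\in\mathbb{C}$ is a strong PV number, then $R_\lambda(S)$ is uniformly discrete for any finite set $S\subseteq\mathbb{Q}(\lambda)$.
   Context: For $\lambda\in\mathbb{C}$, a set $A\subseteq\mathbb{C}$ is $\lambda$-convex if for all $a,b\in A$ the point $(1-\lambda)a+\lambda b$ is in $A$; it is $\lambda$-clonvex if it is $\lambda$-convex and topologically closed in $\mathbb{C}$. For $S\subseteq\mathbb{C}$, $R_\lambda(S)$ denotes the smallest $\lambda$-clonvex set containing $S$. A strong PV number (sPV number) is an algebraic integer $\alpha\in\mathbb{C}$ all of whose Galois conjugates over $\mathbb{Q}$, other than $\alpha$ and its complex conjugate $\alpha^*$, lie in the open real interval $(0,1)$. A set $A\subseteq\mathbb{C}$ is uniformly discrete if there is $r>0$ such that $B_r(x)\cap B_r(y)=\emptyset$ for all distinct $x,y\in A$, where $B_r(x)$ is the open ball of radius $r$ centered at $x$ (equivalently, distances between distinct points of $A$ are bounded below by a positive constant). *)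

theory Defs
  imports
    "HOL-Analysis.Analysis"
    "HOL-Computational_Algebra.Computational_Algebra"
begin

definition lambda_convex :: "complex \<Rightarrow> complex set \<Rightarrow> bool" where
  "lambda_convex l A \<longleftrightarrow> (\<forall>a\<in>A. \<forall>b\<in>A. (1 - l) * a + l * b \<in> A)"

definition lambda_clonvex :: "complex \<Rightarrow> complex set \<Rightarrow> bool" where
  "lambda_clonvex l A \<longleftrightarrow> lambda_convex l A \<and> closed A"

text \<open>The set \<open>R\<^sub>\<lambda>(S)\<close>; that the hull is indeed the smallest such set is
  \<open>lambda_clonvex_hull_least\<close> below.\<close>

definition clonvex_hull :: "complex \<Rightarrow> complex set \<Rightarrow> complex set" where
  "clonvex_hull l S = lambda_clonvex l hull S"

lemma lambda_clonvex_hull_least: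
  "lambda_clonvex l (clonvex_hull l S)"
  "S \<subseteq> clonvex_hull l S"
  "lambda_clonvex l A \<Longrightarrow> S \<subseteq> A \<Longrightarrow> clonvex_hull l S \<subseteq> A"
proof -
  show "lambda_clonvex l (clonvex_hull l S)"
    unfolding clonvex_hull_def
    by (rule hull_in) (auto simp: lambda_clonvex_def lambda_convex_def)
  show "S \<subseteq> clonvex_hull l S"
    unfolding clonvex_hull_def by (rule hull_subset)
  show "lambda_clonvex l A \<Longrightarrow> S \<subseteq> A \<Longrightarrow> clonvex_hull l S \<subseteq> A"
    unfolding clonvex_hull_def by (rule hull_minimal)
qed

definition complex_subfield :: "complex set \<Rightarrow> bool" where
  "complex_subfield K \<longleftrightarrow> 0 \<in> K \<and> 1 \<in> K \<and>
     (\<forall>x\<in>K. \<forall>y\<in>K. x + y \<in> K \<and> x * y \<in> K) \<and>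
     (\<forall>x\<in>K. - x \<in> K \<and> inverse x \<in> K)"

text \<open>\<open>\<rat>(\<alpha>)\<close>. Every subfield of the complex numbers contains the rationals, so
  this is the smallest subfield containing both \<open>\<rat>\<close> and \<open>\<alpha>\<close>.\<close>

definition rat_adjoin :: "complex \<Rightarrow> complex set" where
  "rat_adjoin \<alpha> = complex_subfield hull {\<alpha>}"

text \<open>For algebraic \<open>\<alpha>\<close>, the irreducible rational polynomials vanishing at \<open>\<alpha>\<close> are
  exactly the nonzero rational multiples of its minimal polynomial, so the conjugates
  are the roots of that polynomial (\<open>\<alpha>\<close> included).\<close>

definition galois_conjugate :: "complex \<Rightarrow> complex \<Rightarrow> bool" where
  "galois_conjugate \<alpha> \<beta> \<longleftrightarrow>
     (\<exists>p :: rat poly. irreducible p \<and>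
        poly (map_poly of_rat p) \<alpha> = 0 \<and> poly (map_poly of_rat p) \<beta> = 0)"

definition strong_PV :: "complex \<Rightarrow> bool" where
  "strong_PV \<alpha> \<longleftrightarrow> algebraic_int \<alpha> \<and>
     (\<forall>\<beta>. galois_conjugate \<alpha> \<beta> \<and> \<beta> \<noteq> \<alpha> \<and> \<beta> \<noteq> cnj \<alpha> \<longrightarrow>
        \<beta> \<in> complex_of_real ` {0<..<1})"

end

theory Submission
  imports Defs "HOL-Computational_Algebra.Field_as_Ring"
begin

text \<open>Write the points of \<open>S\<close> as \<open>q(\<lambda>)\<close> with rational polynomials \<open>q\<close> having a common denominator
  \<open>N\<close> and satisfying \<open>\<bar>q(r)\<bar> \<le> C\<close> at every conjugate \<open>r \<in> (0,1)\<close>. The set of all such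
  values \<open>q(\<lambda>)\<close> is \<open>\<lambda>\<close>-convex, since replacing \<open>a, b\<close> by \<open>(1 - X) a + X b\<close> is a genuine convex
  combination at each \<open>r\<close>. A difference of two of its points that is smaller than 1 comes from
  a polynomial with denominator \<open>N\<close> that is bounded at all roots of the minimal polynomial of
  \<open>\<lambda>\<close>; by Lagrange interpolation only finitely many values at \<open>\<lambda>\<close> arise in this way. Hence the
  set is uniformly discrete, so closed, and it contains the hull.\<close>

section \<open>Evaluating rational polynomials\<close>

definition rpoly :: "rat poly \<Rightarrow> 'a::field_char_0 \<Rightarrow> 'a" where
  "rpoly q x = poly (map_poly of_rat q) x"

lemma map_poly_of_rat_add:
  "map_poly (of_rat :: rat \<Rightarrow> 'a::field_char_0) (p + q) = map_poly of_rat p + map_poly of_rat q"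
  by (intro poly_eqI) (simp add: coeff_map_poly of_rat_add)

lemma rpoly_0 [simp]: "rpoly 0 x = 0"
  by (simp add: rpoly_def)

lemma rpoly_pCons [simp]: "rpoly (pCons a q) x = of_rat a + x * rpoly q x"
  by (simp add: rpoly_def map_poly_pCons)

lemma rpoly_1 [simp]: "rpoly 1 x = 1"
  by (simp add: one_pCons)

lemma rpoly_add [simp]: "rpoly (p + q) x = rpoly p x + rpoly q x"
  by (simp add: rpoly_def map_poly_of_rat_add)

lemma rpoly_smult [simp]: "rpoly (smult c q) x = of_rat c * rpoly q x"
  by (induction q) (simp_all add: of_rat_mult algebra_simps)

lemma rpoly_minus [simp]: "rpoly (- q) x = - rpoly q x"
  using rpoly_smult[of "-1" q x] by simp

lemma rpoly_diff [simp]: "rpoly (p - q) x = rpoly p x - rpoly q x"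
  using rpoly_add[of p "- q" x] by simp

lemma rpoly_mult [simp]: "rpoly (p * q) x = rpoly p x * rpoly q x"
  by (induction p) (simp_all add: algebra_simps)

lemma rpoly_cnj: "rpoly q (cnj x) = cnj (rpoly q x)"
proof (induction q)
  case (pCons a q)
  have "cnj (of_rat a) = of_rat a"
    by (cases a) (simp add: of_rat_rat)
  with pCons show ?case by simp
qed simp

lemma rpoly_mod:
  assumes "rpoly p x = 0"
  shows "rpoly (q mod p) x = rpoly q x"
proof -
  have "rpoly q x = rpoly (q div p * p + q mod p) x"
    by (simp only: div_mult_mod_eq)
  also have "\<dots> = rpoly (q mod p) x"
    unfolding rpoly_add rpoly_mult using assms by simp
  finally show ?thesis ..
qed

lemma pderiv_map_poly_of_rat:
  "pderiv (map_poly (of_rat :: rat \<Rightarrow> 'a::field_char_0) p) = map_poly of_rat (pderiv p)"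
  by (intro poly_eqI) (simp add: coeff_pderiv coeff_map_poly of_rat_mult of_rat_add)

lemma degree_map_poly_of_rat [simp]:
  "degree (map_poly (of_rat :: rat \<Rightarrow> 'a::field_char_0) p) = degree p"
  by (rule degree_map_poly) simp

section \<open>Irreducible rational polynomials and their roots\<close>

lemma irreducible_rpoly_bezout:
  fixes p q :: "rat poly"
  assumes "irreducible p" "\<not> p dvd q"
  obtains a b where "a * p + b * q = 1"
proof -
  have "prime_elem p" using assms(1) by (rule field_poly_irreducible_imp_prime)
  hence "coprime p q" using assms(2) by (rule prime_elem_imp_coprime)
  hence "gcd p q = 1" by simp
  hence "fst (bezout_coefficients p q) * p + snd (bezout_coefficients p q) * q = 1"
    using bezout_coefficients_fst_snd[of p q] by simp
  thus thesis by (rule that)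
qed

text \<open>Otherwise a Bezout identity for \<open>p\<close> and \<open>q\<close>, evaluated at the
  common root \<open>x\<close>, would read 0 = 1.\<close>

lemma irreducible_rpoly_dvd:
  fixes x :: "'a::field_char_0"
  assumes "irreducible p" "rpoly p x = 0" "rpoly q x = 0"
  shows "p dvd q"
proof (rule ccontr)
  assume "\<not> p dvd q"
  then obtain a b where "a * p + b * q = 1"
    using assms(1) irreducible_rpoly_bezout by blast
  hence "rpoly (a * p + b * q) x = 1" by simp
  thus False using assms by simp
qed

text \<open>A nonzero polynomial of least degree vanishing at \<open>x\<close> is irreducible: in
  any factorization one factor vanishes at \<open>x\<close>, hence has full degree and leaves a
  constant for the other.\<close>

lemma ex_irreducible_rpoly:
  fixes x :: "'a::field_char_0"
  assumes "f \<noteq> 0" "rpoly f x = 0"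
  obtains p where "irreducible p" "rpoly p x = 0"
proof -
  obtain p where p: "p \<noteq> 0" "rpoly p x = 0"
      and min: "\<And>q. q \<noteq> 0 \<Longrightarrow> rpoly q x = 0 \<Longrightarrow> degree p \<le> degree q"
    using ex_has_least_nat[of "\<lambda>p. p \<noteq> 0 \<and> rpoly p x = 0" f degree] assms by metis
  have "irreducible p"
  proof (rule irreducibleI)
    show "p \<noteq> 0" by fact
    show "\<not> is_unit p"
    proof
      assume "is_unit p"
      then obtain q where "1 = p * q" by (auto elim: dvdE)
      hence "rpoly (p * q) x = 1" using rpoly_1 by metis
      thus False using p by simp
    qed
    have unit: "is_unit b" if "p = a * b" "rpoly a x = 0" for a b
    proof -
      have nz: "a \<noteq> 0" "b \<noteq> 0" using that p by auto
      hence "degree b = 0" using min[of a] that by (simp add: degree_mult_eq)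
      thus ?thesis using nz by (simp add: is_unit_iff_degree)
    qed
    fix a b assume ab: "p = a * b"
    hence "rpoly a x = 0 \<or> rpoly b x = 0" using p by simp
    thus "is_unit a \<or> is_unit b"
      using unit[of a b] unit[of b a] ab by (auto simp: mult.commute)
  qed
  thus thesis using p that by blast
qed

text \<open>In characteristic 0 the derivative of \<open>p\<close> is nonzero of smaller degree,
  hence coprime to \<open>p\<close>, so all complex roots are simple. These \<open>degree p\<close>
  distinct roots later serve as interpolation nodes for remainders modulo \<open>p\<close>.\<close>

lemma irreducible_card_roots:
  fixes p :: "rat poly"
  assumes "irreducible p"
  shows "card {x::complex. rpoly p x = 0} = degree p"
proof -
  let ?P = "map_poly of_rat p :: complex poly"
  have p0: "p \<noteq> 0" and deg: "degree p \<noteq> 0"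
    using assms by (auto simp: irreducible_def is_unit_iff_degree)
  have "\<not> p dvd pderiv p"
  proof
    assume "p dvd pderiv p"
    moreover have "pderiv p \<noteq> 0" using deg by (simp add: pderiv_eq_0_iff)
    ultimately have "degree p \<le> degree (pderiv p)" by (rule dvd_imp_degree_le)
    thus False using deg by (simp add: degree_pderiv)
  qed
  then obtain a b where ab: "a * p + b * pderiv p = 1"
    using assms irreducible_rpoly_bezout by blast
  have "\<not> (poly ?P x = 0 \<and> poly (pderiv ?P) x = 0)" for x
  proof
    assume "poly ?P x = 0 \<and> poly (pderiv ?P) x = 0"
    hence "rpoly p x = 0" "rpoly (pderiv p) x = 0"
      by (simp_all add: rpoly_def pderiv_map_poly_of_rat)
    hence "rpoly (a * p + b * pderiv p) x = 0" by simp
    thus False unfolding ab by simp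
  qed
  hence "rsquarefree ?P" by (simp add: rsquarefree_roots)
  hence eq: "smult (lead_coeff ?P) (\<Prod>z|poly ?P z = 0. [:-z, 1:]) = ?P"
    by (rule complex_poly_decompose_rsquarefree)
  have "?P \<noteq> 0" using p0 by (simp add: map_poly_eq_0_iff)
  hence "degree ?P = degree (\<Prod>z|poly ?P z = 0. [:-z, 1:])"
    using eq by (metis degree_smult_eq leading_coeff_0_iff)
  also have "\<dots> = (\<Sum>z|poly ?P z = 0. degree [:-z, 1:])"
    by (rule degree_prod_eq_sum_degree) simp
  also have "\<dots> = card {z. poly ?P z = 0}" by simp
  finally show ?thesis by (simp add: rpoly_def)
qed

text \<open>The values at \<open>l\<close> already form a field: if \<open>p\<close> does not divide
  \<open>q\<close>, the Bezout coefficient of \<open>q\<close> takes the inverse value at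
  \<open>l\<close>.\<close>

lemma rat_adjoin_subset_range_rpoly:
  assumes "irreducible p" "rpoly p l = 0"
  shows "rat_adjoin l \<subseteq> range (\<lambda>q. rpoly q l)"
proof -
  have cl: "rpoly q l + rpoly r l \<in> range (\<lambda>q. rpoly q l)"
       "rpoly q l * rpoly r l \<in> range (\<lambda>q. rpoly q l)"
       "- rpoly q l \<in> range (\<lambda>q. rpoly q l)" for q r
    using rpoly_add[of q r l] rpoly_mult[of q r l] rpoly_minus[of q l]
    by (metis rangeI)+
  have inv: "inverse (rpoly q l) \<in> range (\<lambda>q. rpoly q l)" for q
  proof (cases "rpoly q l = 0")
    case True
    thus ?thesis using rpoly_0 by (metis inverse_zero rangeI)
  next
    case False
    have "\<not> p dvd q" using False assms(2) by (auto elim!: dvdE)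
    then obtain a b where "a * p + b * q = 1"
      using assms(1) irreducible_rpoly_bezout by blast
    hence "rpoly (a * p + b * q) l = 1" by simp
    hence "rpoly b l * rpoly q l = 1" using assms by simp
    hence "inverse (rpoly q l) = rpoly b l" by (metis inverse_unique mult.commute)
    thus ?thesis by simp
  qed
  have 01: "0 \<in> range (\<lambda>q. rpoly q l)" "1 \<in> range (\<lambda>q. rpoly q l)"
    using rpoly_0 rpoly_1 by (metis rangeI)+
  have "complex_subfield (range (\<lambda>q. rpoly q l))"
    unfolding complex_subfield_def using cl inv 01 by blast
  moreover have "l = rpoly [:0, 1:] l" by simp
  hence "{l} \<subseteq> range (\<lambda>q. rpoly q l)" by blast
  ultimately show ?thesis unfolding rat_adjoin_def by (intro hull_minimal) auto
qed

section \<open>Polynomials with a common denominator\<close>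

text \<open>For \<open>N > 0\<close> this is (1/N) Z[X], a group closed under multiplication by
  X.\<close>

definition denom_polys :: "nat \<Rightarrow> rat poly set" where
  "denom_polys N = {q. \<forall>i. of_nat N * coeff q i \<in> \<int>}"

lemma denom_polys_0 [simp]: "0 \<in> denom_polys N"
  by (simp add: denom_polys_def)

lemma denom_polys_add: "p \<in> denom_polys N \<Longrightarrow> q \<in> denom_polys N \<Longrightarrow> p + q \<in> denom_polys N"
  by (auto simp: denom_polys_def distrib_left)

lemma denom_polys_diff: "p \<in> denom_polys N \<Longrightarrow> q \<in> denom_polys N \<Longrightarrow> p - q \<in> denom_polys N"
  by (auto simp: denom_polys_def right_diff_distrib)

lemma denom_polys_pCons_0: "p \<in> denom_polys N \<Longrightarrow> pCons 0 p \<in> denom_polys N"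
  by (auto simp: denom_polys_def coeff_pCons split: nat.splits)

lemma denom_polys_smult:
  assumes "of_nat M * c \<in> \<int>" "p \<in> denom_polys N"
  shows "smult c p \<in> denom_polys (M * N)"
  unfolding denom_polys_def
proof safe
  fix i
  have "(of_nat M * c) * (of_nat N * coeff p i) \<in> \<int>"
    using assms unfolding denom_polys_def by (intro Ints_mult[of "of_nat M * c"]) blast+
  thus "of_nat (M * N) * coeff (smult c p) i \<in> \<int>" by (simp add: mult_ac)
qed

lemma denom_polys_sum:
  "(\<And>i. i \<in> I \<Longrightarrow> f i \<in> denom_polys N) \<Longrightarrow> sum f I \<in> denom_polys N"
  by (induction I rule: infinite_finite_induct) (auto intro: denom_polys_add)

lemma denom_polys_mono_dvd:
  assumes "N dvd M"
  shows "denom_polys N \<subseteq> denom_polys M"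
proof
  fix p assume p: "p \<in> denom_polys N"
  obtain k where M: "M = N * k" using assms by (rule dvdE)
  have "of_nat k * (of_nat N * coeff p i) \<in> \<int>" for i
    using p by (intro Ints_mult[of "of_nat k"]) (simp_all add: denom_polys_def)
  thus "p \<in> denom_polys M" by (simp add: denom_polys_def M mult_ac)
qed

lemma ex_denom_poly: "\<exists>N>0. q \<in> denom_polys N"
proof (induction q)
  case 0
  show ?case by (intro exI[of _ 1]) simp
next
  case (pCons a q)
  then obtain N where N: "N > 0" "q \<in> denom_polys N" by blast
  obtain m n where mn: "quotient_of a = (m, n)" by fastforce
  hence n: "n > 0" and a: "a = of_int m / of_int n"
    by (auto simp: quotient_of_denom_pos quotient_of_div)
  have "q \<in> denom_polys (nat n * N)"
    using N denom_polys_mono_dvd[of N "nat n * N"] by auto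
  hence q: "of_nat (nat n * N) * coeff q i \<in> \<int>" for i by (simp add: denom_polys_def)
  have "of_nat (nat n * N) * a = of_int (m * int N)"
    using n a by (simp add: field_simps)
  hence "of_nat (nat n * N) * a \<in> \<int>" by (metis Ints_of_int)
  hence "pCons a q \<in> denom_polys (nat n * N)"
    using q by (auto simp: denom_polys_def coeff_pCons split: nat.splits)
  thus ?case using n N by (intro exI[of _ "nat n * N"]) auto
qed

lemma ex_common_denom_polys:
  assumes "finite Q"
  shows "\<exists>N>0. Q \<subseteq> denom_polys N"
  using assms
proof (induction Q rule: finite_induct)
  case empty
  show ?case by auto
next
  case (insert q Q)
  then obtain N where N: "N > 0" "Q \<subseteq> denom_polys N" by blast
  obtain M where M: "M > 0" "q \<in> denom_polys M" using ex_denom_poly by blast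
  have "insert q Q \<subseteq> denom_polys (N * M)"
    using N M denom_polys_mono_dvd[of N "N * M"] denom_polys_mono_dvd[of M "N * M"] by auto
  thus ?case using N M by (intro exI[of _ "N * M"]) auto
qed

section \<open>Denominators of remainders modulo a fixed polynomial\<close>

lemma poly_mod_sum:
  fixes p :: "'a::field poly"
  shows "sum f I mod p = (\<Sum>i\<in>I. f i mod p)"
  by (induction I rule: infinite_finite_induct) (auto simp: poly_mod_add_left)

text \<open>The relation \<open>f\<close> expresses \<open>X\<^sup>i\<close> modulo \<open>p\<close> as an integer combination of lower powers, so
  the denominators of the remainders stay bounded. This replaces Gauss's lemma.\<close>

lemma ex_denom_monom_mod:
  fixes p f :: "rat poly"
  assumes "p dvd f" "lead_coeff f = 1" "\<And>i. coeff f i \<in> \<int>"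
  shows "\<exists>M>0. \<forall>i. monom 1 i mod p \<in> denom_polys M"
proof -
  define n where "n = degree f"
  \<comment> \<open>The first \<open>n\<close> remainders alone fix \<open>M\<close>; the recursion
    below introduces no new denominators.\<close>
  obtain M where M: "M > 0" "(\<lambda>i. monom 1 i mod p) ` {..<n} \<subseteq> denom_polys M"
    using ex_common_denom_polys[of "(\<lambda>i. monom 1 i mod p) ` {..<n}"] by auto
  have "monom 1 i mod p \<in> denom_polys M" for i
  proof (induction i rule: less_induct)
    case (less i)
    show ?case
    proof (cases "i < n")
      case True
      thus ?thesis using M by auto
    next
      case False
      \<comment> \<open>Splitting off the leading term of \<open>f\<close> and multiplying by X^(i -
        n) turns \<open>p dvd f\<close> into a recursion for the remainder of X^i.\<close>
      have "f = (\<Sum>j\<le>n. monom (coeff f j) j)"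
        unfolding n_def by (rule poly_as_sum_of_monoms[symmetric])
      also have "\<dots> = monom 1 n + (\<Sum>j<n. monom (coeff f j) j)"
        using assms(2) by (simp add: n_def lessThan_Suc_atMost[symmetric])
      finally have "monom 1 (i - n) * f =
          monom 1 (i - n) * (monom 1 n + (\<Sum>j<n. monom (coeff f j) j))"
        by (rule arg_cong)
      hence "monom 1 (i - n) * f =
          monom 1 (i - n) * monom 1 n + monom 1 (i - n) * (\<Sum>j<n. monom (coeff f j) j)"
        by (simp only: distrib_left)
      hence "monom 1 (i - n) * f = monom 1 i + (\<Sum>j<n. smult (coeff f j) (monom 1 (i - n + j)))"
        using False by (simp add: mult_monom sum_distrib_left smult_monom)
      moreover have "p dvd monom 1 (i - n) * f" using assms(1) by simp
      ultimately have "(monom 1 i + (\<Sum>j<n. smult (coeff f j) (monom 1 (i - n + j)))) mod p = 0"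
        by (simp add: dvd_eq_mod_eq_0)
      hence "monom 1 i mod p + (\<Sum>j<n. smult (coeff f j) (monom 1 (i - n + j) mod p)) = 0"
        by (simp add: poly_mod_add_left poly_mod_sum mod_smult_left)
      hence eq: "monom 1 i mod p = 0 - (\<Sum>j<n. smult (coeff f j) (monom 1 (i - n + j) mod p))"
        by (simp only: add_eq_0_iff2 diff_0)
      \<comment> \<open>Since \<open>j < n\<close> and \<open>n \<le> i\<close>, the exponent
        \<open>i - n + j\<close> is below \<open>i\<close>, so the induction hypothesis applies; the
        integer coefficient contributes denominator 1.\<close>
      have "smult (coeff f j) (monom 1 (i - n + j) mod p) \<in> denom_polys M" if "j < n" for j
        using denom_polys_smult[of 1 "coeff f j" _ M] assms(3) less[of "i - n + j"] that False
        by auto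
      thus ?thesis unfolding eq by (intro denom_polys_diff denom_polys_sum) auto
    qed
  qed
  thus ?thesis using M by blast
qed

text \<open>Reduction modulo \<open>p\<close> is linear, so the denominators \<open>N\<close> of the
  coefficients and \<open>M\<close> of the monomial remainders multiply.\<close>

lemma denom_polys_mod:
  assumes "\<And>i. monom 1 i mod p \<in> denom_polys M" "q \<in> denom_polys N"
  shows "q mod p \<in> denom_polys (N * M)"
proof -
  have "q mod p = (\<Sum>i\<le>degree q. smult (coeff q i) (monom 1 i)) mod p"
    using poly_as_sum_of_monoms[of q] by (simp add: smult_monom)
  also have "\<dots> = (\<Sum>i\<le>degree q. smult (coeff q i) (monom 1 i mod p))"
    by (simp add: poly_mod_sum mod_smult_left)
  also have "\<dots> \<in> denom_polys (N * M)"
    using assms by (intro denom_polys_sum denom_polys_smult) (auto simp: denom_polys_def)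
  finally show ?thesis .
qed

section \<open>Boundedness at the conjugates leaves finitely many values\<close>

text \<open>Both sides have degree below \<open>card R\<close> and agree on \<open>R\<close>, so a
  nonzero difference would have more roots than its degree allows.\<close>

lemma lagrange_interpolation:
  fixes q :: "'a::field poly"
  assumes "finite R" "degree q < card R"
  shows "q = (\<Sum>r\<in>R. smult (poly q r)
    (smult (inverse (\<Prod>s\<in>R - {r}. r - s)) (\<Prod>s\<in>R - {r}. [:-s, 1:])))"
    (is "_ = (\<Sum>r\<in>R. smult (poly q r) (?L r))")
proof (rule ccontr)
  define h where "h = (\<Sum>r\<in>R. smult (poly q r) (?L r))"
  assume "q \<noteq> (\<Sum>r\<in>R. smult (poly q r) (?L r))"
  hence nz: "q - h \<noteq> 0" by (simp add: h_def)
  have L: "poly (?L r) t = (if t = r then 1 else 0)" if "r \<in> R" "t \<in> R" for r t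
  proof (cases "t = r")
    case True
    have "(\<Prod>s\<in>R - {r}. r - s) \<noteq> 0" using assms(1) by auto
    thus ?thesis using True by (simp add: poly_prod)
  next
    case False
    have "(\<Prod>s\<in>R - {r}. t - s) = 0"
      using assms(1) that False by (intro prod_zero) auto
    thus ?thesis using False by (simp add: poly_prod)
  qed
  have "poly h t = poly q t" if "t \<in> R" for t
  proof -
    have "poly h t = (\<Sum>r\<in>R. poly q r * poly (?L r) t)"
      unfolding h_def poly_sum by (simp only: poly_smult)
    also have "\<dots> = (\<Sum>r\<in>R. if t = r then poly q r else 0)"
      using L that by (intro sum.cong) auto
    finally show ?thesis using that assms(1) by simp
  qed
  hence "R \<subseteq> {t. poly (q - h) t = 0}" by auto
  hence "card R \<le> card {t. poly (q - h) t = 0}"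
    using nz by (intro card_mono poly_roots_finite)
  also have "\<dots> \<le> degree (q - h)"
    using nz by (rule card_poly_roots_bound)
  also have "\<dots> < card R"
  proof (rule degree_diff_less)
    show "degree q < card R" by fact
    have "degree (smult (poly q r) (?L r)) \<le> card R - 1" if "r \<in> R" for r
    proof -
      have "degree (smult (poly q r) (?L r)) \<le> degree (\<Prod>s\<in>R - {r}. [:-s, 1:])"
        by (meson degree_smult_le order_trans)
      also have "\<dots> = (\<Sum>s\<in>R - {r}. degree [:-s, 1:])"
        by (rule degree_prod_eq_sum_degree) simp
      finally show ?thesis using that assms(1) by simp
    qed
    hence "degree h \<le> card R - 1" unfolding h_def
      by (intro degree_sum_le assms(1))
    \<comment> \<open>The hypothesis \<open>degree q < card R\<close> makes \<open>card R\<close>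
      positive, which turns the bound \<open>card R - 1\<close> into a strict one.\<close>
    thus "degree h < card R" using assms(2) by simp
  qed
  finally show False by simp
qed

text \<open>By interpolation each coefficient is a fixed linear combination of the values on
  \<open>R\<close>, so \<open>B\<close> depends only on \<open>R\<close> and
  \<open>C\<close>.\<close>

lemma ex_coeff_bound:
  fixes R :: "'a::real_normed_field set"
  assumes "finite R"
  shows "\<exists>B. \<forall>q i. degree q < card R \<longrightarrow> (\<forall>r\<in>R. norm (poly q r) \<le> C) \<longrightarrow> norm (coeff q i) \<le> B"
proof -
  define L where "L r = smult (inverse (\<Prod>s\<in>R - {r}. r - s)) (\<Prod>s\<in>R - {r}. [:-s, 1:])" for r
  define B where "B = (\<Sum>r\<in>R. C * (\<Sum>i\<le>degree (L r). norm (coeff (L r) i)))"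
  have "norm (coeff q i) \<le> B" if q: "degree q < card R" "\<forall>r\<in>R. norm (poly q r) \<le> C" for q i
  proof -
    have *: "norm (coeff (L r) i) \<le> (\<Sum>i\<le>degree (L r). norm (coeff (L r) i))" for r
    proof (cases "i \<le> degree (L r)")
      case True
      thus ?thesis by (intro member_le_sum) auto
    next
      case False
      thus ?thesis by (simp add: coeff_eq_0 sum_nonneg)
    qed
    have "coeff q i = coeff (\<Sum>r\<in>R. smult (poly q r) (L r)) i"
      using lagrange_interpolation[OF assms q(1)] unfolding L_def by simp
    also have "\<dots> = (\<Sum>r\<in>R. poly q r * coeff (L r) i)"
      by (simp add: coeff_sum)
    also have "norm \<dots> \<le> (\<Sum>r\<in>R. norm (poly q r) * norm (coeff (L r) i))"
      by (rule order_trans[OF norm_sum]) (simp add: norm_mult)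
    \<comment> \<open>Monotonicity of the product uses \<open>C \<ge> 0\<close>, which follows from
      the bound at \<open>r\<close> itself.\<close>
    also have "\<dots> \<le> B" unfolding B_def
      using q(2) * by (intro sum_mono mult_mono) (auto intro: order_trans[OF norm_ge_zero])
    finally show ?thesis .
  qed
  thus ?thesis by blast
qed

lemma finite_polys_coeffs_in:
  assumes "finite X"
  shows "finite {q. degree q < d \<and> (\<forall>i. coeff q i \<in> X)}"
proof (rule finite_subset)
  show "finite (Poly ` {xs. set xs \<subseteq> X \<and> length xs = d})"
    using assms by (intro finite_imageI finite_lists_length_eq)
  show "{q. degree q < d \<and> (\<forall>i. coeff q i \<in> X)} \<subseteq> Poly ` {xs. set xs \<subseteq> X \<and> length xs = d}"
  proof safe
    fix q assume q: "degree q < d" "\<forall>i. coeff q i \<in> X"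
    have "q = Poly (map (coeff q) [0..<d])"
      using q(1) by (intro poly_eqI) (auto simp: nth_default_def coeff_eq_0)
    thus "q \<in> Poly ` {xs. set xs \<subseteq> X \<and> length xs = d}"
      using q(2) by (intro image_eqI[where x = "map (coeff q) [0..<d]"]) auto
  qed
qed

text \<open>The lattice (1/N) Z meets a bounded interval in finitely many points. The norm is
  complex to match the coefficient bound from interpolation.\<close>

lemma finite_bounded_denom_rats:
  assumes "N > 0"
  shows "finite {x::rat. of_nat N * x \<in> \<int> \<and> norm (of_rat x :: complex) \<le> B}"
proof (rule finite_subset)
  let ?b = "\<lceil>of_nat N * B\<rceil>"
  show "finite ((\<lambda>k. of_int k / of_nat N :: rat) ` {-?b..?b})" by simp
  show "{x::rat. of_nat N * x \<in> \<int> \<and> norm (of_rat x :: complex) \<le> B}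
      \<subseteq> (\<lambda>k. of_int k / of_nat N) ` {-?b..?b}"
  proof safe
    fix x :: rat
    assume "of_nat N * x \<in> \<int>" and x: "norm (of_rat x :: complex) \<le> B"
    then obtain k where k: "of_nat N * x = of_int k" by (auto elim: Ints_cases)
    have xk: "x = of_int k / of_nat N" using k assms by (simp add: field_simps)
    have "of_rat x = (of_int k / of_nat N :: complex)"
      unfolding xk by (simp add: of_rat_divide)
    hence "norm (of_rat x :: complex) = \<bar>of_int k\<bar> / of_nat N"
      by (simp add: norm_divide)
    hence "\<bar>of_int k\<bar> = of_nat N * norm (of_rat x :: complex)" using assms by simp
    also have "\<dots> \<le> of_nat N * B" using x by (intro mult_left_mono) auto
    finally have "\<bar>of_int k\<bar> \<le> of_nat N * B" .
    hence "of_int \<bar>k\<bar> \<le> of_nat N * B" by simp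
    hence "\<bar>k\<bar> \<le> ?b" by linarith
    thus "x \<in> (\<lambda>k. of_int k / of_nat N) ` {-?b..?b}" using xk by (intro image_eqI[of _ _ k]) auto
  qed
qed

text \<open>Replacing \<open>q\<close> by \<open>q mod p\<close> preserves its values at all roots
  of \<open>p\<close>. These values bound the coefficients, and integrality of \<open>l\<close>
  bounds their denominators, so finitely many remainders occur.\<close>

lemma finite_bounded_values:
  fixes l :: complex
  assumes "irreducible p" "rpoly p l = 0" "algebraic_int l" "N > 0"
  shows "finite {rpoly q l | q. q \<in> denom_polys N \<and> (\<forall>r::complex. rpoly p r = 0 \<longrightarrow> norm (rpoly q r) \<le> C)}"
proof -
  define R where "R = {r::complex. rpoly p r = 0}"
  have p0: "p \<noteq> 0" and deg: "degree p \<noteq> 0"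
    using assms(1) by (auto simp: irreducible_def is_unit_iff_degree)
  have cardR: "card R = degree p" unfolding R_def using assms(1) by (rule irreducible_card_roots)
  hence finR: "finite R" using deg by (intro card_ge_0_finite) simp
  obtain g :: "int poly" where g: "poly (map_poly of_int g) l = 0" "lead_coeff g = 1"
    using assms(3) unfolding algebraic_int_altdef_ipoly by blast
  define f :: "rat poly" where "f = map_poly of_int g"
  have deg_f: "degree f = degree g" unfolding f_def by (rule degree_map_poly) simp
  have "rpoly f l = 0"
    using g(1) by (simp add: f_def rpoly_def map_poly_map_poly o_def)
  \<comment> \<open>\<open>f\<close> is the monic multiple of \<open>p\<close> with integer
    coefficients that controls denominators modulo \<open>p\<close>.\<close>
  hence "p dvd f" using assms irreducible_rpoly_dvd by blast
  moreover have "lead_coeff f = 1" "coeff f i \<in> \<int>" for i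
    using g(2) deg_f by (simp_all add: f_def coeff_map_poly)
  ultimately obtain M where M: "M > 0" "\<And>i. monom 1 i mod p \<in> denom_polys M"
    using ex_denom_monom_mod by blast
  obtain B where B: "\<And>q i. degree q < card R \<Longrightarrow> \<forall>r\<in>R. norm (poly q r) \<le> C \<Longrightarrow> norm (coeff q i) \<le> B"
    using ex_coeff_bound[OF finR, of C] by blast
  define X where "X = {x::rat. of_nat (N * M) * x \<in> \<int> \<and> norm (of_rat x :: complex) \<le> B}"
  have "finite X" unfolding X_def using assms(4) M by (intro finite_bounded_denom_rats) simp
  hence fin: "finite {q. degree q < degree p \<and> (\<forall>i. coeff q i \<in> X)}"
    by (rule finite_polys_coeffs_in)
  show ?thesis
  proof (rule finite_subset)
    show "finite ((\<lambda>q. rpoly q l) ` {q. degree q < degree p \<and> (\<forall>i. coeff q i \<in> X)})"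
      using fin by (rule finite_imageI)
    show "{rpoly q l | q. q \<in> denom_polys N \<and> (\<forall>r::complex. rpoly p r = 0 \<longrightarrow> norm (rpoly q r) \<le> C)}
      \<subseteq> (\<lambda>q. rpoly q l) ` {q. degree q < degree p \<and> (\<forall>i. coeff q i \<in> X)}"
    proof safe
      fix q assume q: "q \<in> denom_polys N" "\<forall>r::complex. rpoly p r = 0 \<longrightarrow> norm (rpoly q r) \<le> C"
      let ?q = "q mod p"
      have d: "degree ?q < degree p" using degree_mod_less[OF p0, of q] deg by auto
      have "?q \<in> denom_polys (N * M)" using M(2) q(1) by (rule denom_polys_mod)
      moreover have "norm (of_rat (coeff ?q i) :: complex) \<le> B" for i
      proof -
        have "norm (coeff (map_poly of_rat ?q :: complex poly) i) \<le> B"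
        proof (rule B)
          show "degree (map_poly of_rat ?q :: complex poly) < card R"
            using d cardR by simp
          show "\<forall>r\<in>R. norm (poly (map_poly of_rat ?q) r) \<le> C"
            using q(2) by (simp add: R_def rpoly_mod flip: rpoly_def)
        qed
        thus ?thesis by (simp add: coeff_map_poly)
      qed
      ultimately have "\<forall>i. coeff ?q i \<in> X" by (simp add: X_def denom_polys_def)
      thus "rpoly q l \<in> (\<lambda>q. rpoly q l) ` {q. degree q < degree p \<and> (\<forall>i. coeff q i \<in> X)}"
        using d rpoly_mod[OF assms(2), of q] by (intro image_eqI[where x = ?q]) auto
    qed
  qed
qed

section \<open>The model set\<close>

text \<open>With \<open>T\<close> a set of conjugates of \<open>l\<close>, this is a cut-and-project
  set: the points of (1/N) Z[\<open>l\<close>] whose conjugates at \<open>T\<close> lie in the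
  window given by the disc of radius \<open>C\<close>.\<close>

definition model_set :: "complex set \<Rightarrow> nat \<Rightarrow> real \<Rightarrow> complex \<Rightarrow> complex set" where
  "model_set T N C l = {rpoly q l | q. q \<in> denom_polys N \<and> (\<forall>r\<in>T. norm (rpoly q r) \<le> C)}"

text \<open>At each \<open>r\<close> in \<open>T\<close> the operation becomes a convex combination
  with real weight \<open>r\<close>, which stays in the disc of radius \<open>C\<close>;
  \<open>l\<close> itself may lie anywhere.\<close>

lemma lambda_convex_model_set:
  assumes "T \<subseteq> complex_of_real ` {0<..<1}"
  shows "lambda_convex l (model_set T N C l)"
  unfolding lambda_convex_def
proof safe
  fix x y assume "x \<in> model_set T N C l" "y \<in> model_set T N C l"
  then obtain a b where a: "x = rpoly a l" "a \<in> denom_polys N" "\<And>r. r \<in> T \<Longrightarrow> norm (rpoly a r) \<le> C"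
    and b: "y = rpoly b l" "b \<in> denom_polys N" "\<And>r. r \<in> T \<Longrightarrow> norm (rpoly b r) \<le> C"
    unfolding model_set_def by blast
  \<comment> \<open>This is (1 - X) a + X b, arranged so that only sums, differences and shifts
    occur and the denominator \<open>N\<close> survives.\<close>
  define c where "c = a + pCons 0 (b - a)"
  have c: "rpoly c t = (1 - t) * rpoly a t + t * rpoly b t" for t :: complex
    by (simp add: c_def algebra_simps)
  have "c \<in> denom_polys N"
    unfolding c_def using a b by (intro denom_polys_add denom_polys_pCons_0 denom_polys_diff)
  moreover have "norm (rpoly c r) \<le> C" if r: "r \<in> T" for r
  proof -
    obtain t where t: "r = of_real t" "0 < t" "t < 1" using assms r by auto
    have "rpoly c r = (1 - t) *\<^sub>R rpoly a r + t *\<^sub>R rpoly b r"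
      unfolding c by (simp add: t(1) scaleR_conv_of_real)
    moreover have "(1 - t) *\<^sub>R rpoly a r + t *\<^sub>R rpoly b r \<in> cball 0 C"
      using t a(3)[OF r] b(3)[OF r] by (intro convexD[OF convex_cball]) auto
    ultimately show ?thesis by simp
  qed
  ultimately show "(1 - l) * x + l * y \<in> model_set T N C l"
    unfolding model_set_def a(1) b(1) c[of l, symmetric]
    by (intro CollectI exI[of _ c]) simp
qed

text \<open>The difference of two close points lies in a finite set, whose nonzero members stay away
  from 0. Closeness controls it at \<open>l\<close>, and conjugation carries this over to
  \<open>cnj l\<close>.\<close>

lemma uniform_discrete_model_set:
  assumes "irreducible p" "rpoly p l = 0" "algebraic_int l" "N > 0"
    and roots: "\<And>r::complex. rpoly p r = 0 \<Longrightarrow> r \<in> T \<or> r = l \<or> r = cnj l"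
  shows "uniform_discrete (model_set T N C l)"
proof -
  \<comment> \<open>\<open>2 * C\<close> bounds differences on \<open>T\<close> by the triangle
    inequality; 1 bounds them at \<open>l\<close> and \<open>cnj l\<close> for points closer than
    1.\<close>
  define D where "D = {rpoly q l | q. q \<in> denom_polys N \<and>
    (\<forall>r::complex. rpoly p r = 0 \<longrightarrow> norm (rpoly q r) \<le> max 1 (2 * C))}"
  have "finite D" unfolding D_def using assms(1-4) by (rule finite_bounded_values)
  then obtain e where e: "e > 0" "\<And>z. z \<in> D \<Longrightarrow> z \<noteq> 0 \<Longrightarrow> e \<le> dist 0 z"
    using finite_set_avoid[of D 0] by metis
  have "x = y" if x: "x \<in> model_set T N C l" and y: "y \<in> model_set T N C l"
    and xy: "dist x y < min e 1" for x y
  proof (rule ccontr)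
    assume "x \<noteq> y"
    obtain a b where a: "x = rpoly a l" "a \<in> denom_polys N" "\<And>r. r \<in> T \<Longrightarrow> norm (rpoly a r) \<le> C"
      and b: "y = rpoly b l" "b \<in> denom_polys N" "\<And>r. r \<in> T \<Longrightarrow> norm (rpoly b r) \<le> C"
      using x y unfolding model_set_def by blast
    have small: "norm (rpoly (a - b) l) < min e 1" using xy a(1) b(1) by (simp add: dist_norm)
    have "norm (rpoly (a - b) r) \<le> max 1 (2 * C)" if r: "rpoly p r = 0" for r :: complex
      using roots[OF r]
    proof (elim disjE)
      assume rT: "r \<in> T"
      show ?thesis
        using norm_triangle_ineq4[of "rpoly a r" "rpoly b r"] a(3)[OF rT] b(3)[OF rT] by simp
    next
      assume "r = l"
      thus ?thesis using small by (simp del: rpoly_diff add: le_max_iff_disj)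
    next
      assume "r = cnj l"
      hence "norm (rpoly (a - b) r) = norm (rpoly (a - b) l)"
        using rpoly_cnj[of "a - b" l] by (simp del: rpoly_diff)
      thus ?thesis using small by (simp del: rpoly_diff add: le_max_iff_disj)
    qed
    hence "rpoly (a - b) l \<in> D"
      unfolding D_def using denom_polys_diff[OF a(2) b(2)] by blast
    moreover have "rpoly (a - b) l \<noteq> 0" using \<open>x \<noteq> y\<close> a(1) b(1) by simp
    ultimately show False using e(2) small by fastforce
  qed
  thus ?thesis unfolding uniform_discrete_def using e(1) by (intro exI[of _ "min e 1"]) auto
qed

theorem theorem12p14:
  fixes l :: complex and S :: "complex set"
  assumes "strong_PV l"
    and "finite S"
    and "S \<subseteq> rat_adjoin l"
  shows "uniform_discrete (clonvex_hull l S)"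
proof -
  have ai: "algebraic_int l" using assms(1) by (simp add: strong_PV_def)
  then obtain g :: "int poly" where g: "poly (map_poly of_int g) l = 0" "lead_coeff g = 1"
    unfolding algebraic_int_altdef_ipoly by blast
  have "rpoly (map_poly of_int g) l = 0"
    using g(1) by (simp add: rpoly_def map_poly_map_poly o_def)
  moreover have "map_poly of_int g \<noteq> (0 :: rat poly)"
    using g(2) by (auto simp: map_poly_eq_0_iff)
  ultimately obtain p where p: "irreducible p" "rpoly p l = 0"
    using ex_irreducible_rpoly[of "map_poly of_int g" l] by metis
  define T where "T = {r. rpoly p r = 0 \<and> r \<noteq> l \<and> r \<noteq> cnj l}"
  \<comment> \<open>\<open>p\<close> itself witnesses that its roots are Galois conjugates of
    \<open>l\<close>, so the strong PV condition applies to those in \<open>T\<close>.\<close>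
  have T: "T \<subseteq> complex_of_real ` {0<..<1}"
    using assms(1) p unfolding strong_PV_def galois_conjugate_def T_def rpoly_def by blast
  have "T \<subseteq> {r. poly (map_poly of_rat p) r = 0}" by (auto simp: T_def rpoly_def)
  moreover have "map_poly of_rat p \<noteq> (0 :: complex poly)"
    using p(1) by (auto simp: map_poly_eq_0_iff)
  ultimately have finT: "finite T" using finite_subset poly_roots_finite by blast
  obtain Q where Q: "finite Q" "S = (\<lambda>q. rpoly q l) ` Q"
    using finite_subset_image[OF assms(2) order_trans[OF assms(3) rat_adjoin_subset_range_rpoly[OF p]]]
    by auto
  obtain N where N: "N > 0" "Q \<subseteq> denom_polys N" using ex_common_denom_polys[OF Q(1)] by blast
  \<comment> \<open>The finitely many representatives take finitely many values on \<open>T\<close>,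
    so one \<open>C\<close> serves them all.\<close>
  define X where "X = (\<lambda>(q, r). rpoly q r) ` (Q \<times> T)"
  have "bounded X"
    unfolding X_def using Q(1) finT by (intro finite_imp_bounded finite_imageI finite_cartesian_product)
  then obtain C where "\<And>z. z \<in> X \<Longrightarrow> norm z \<le> C"
    unfolding bounded_iff by blast
  moreover have "rpoly q r \<in> X" if "q \<in> Q" "r \<in> T" for q r
    unfolding X_def using that by (intro image_eqI[of _ _ "(q, r)"]) auto
  ultimately have C: "norm (rpoly q r) \<le> C" if "q \<in> Q" "r \<in> T" for q r
    using that by simp
  have ud: "uniform_discrete (model_set T N C l)"
    by (rule uniform_discrete_model_set[OF p ai N(1)]) (auto simp: T_def)
  \<comment> \<open>Uniform discreteness supplies closedness, so minimality of the hull applies to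
    the model set.\<close>
  have "lambda_clonvex l (model_set T N C l)"
    using lambda_convex_model_set[OF T] uniform_discrete_imp_closed[OF ud]
    by (simp add: lambda_clonvex_def)
  moreover have "S \<subseteq> model_set T N C l"
    unfolding Q(2) model_set_def using N(2) C by blast
  ultimately have "clonvex_hull l S \<subseteq> model_set T N C l"
    by (rule lambda_clonvex_hull_least(3))
  thus ?thesis using ud unfolding uniform_discrete_def by (meson subsetD)
qed

end
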